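(* Let $\mu$ be a probability measure on $\mathbb{R}$ with $0<\mu([0,\infty))<1$ and $\int_{\mathbb{R}} e^{\epsilon b^2}\,\mu(\mathrm{d}b)<\infty$ for some $\epsilon>0$, and let $\sigma:[0,\infty)\times(0,1)\to\mathbb{R}$ be the associated volatility function (defined in the context). Then for every fixed $\pi\in(0,1)$ the function $t\mapsto\sigma(t,\pi)$ is non-increasing on $[0,\infty)$. Moreover, for every $\pi\in(0,1)$, $t\mapsto \sigma(t,\pi)$ is strictly decreasing on $[0,\infty)$ unless $\mu$ is a two-point distribution, in which case $t\mapsto\sigma(t,\pi)$ is constant.
   Context: For $t\ge 0$, $x\in\mathbb{R}$ let $\mu_{t,x}$ be the probability measure $\mu_{t,x}(\mathrm{d}b)=\dfrac{e^{bx-b^2t/2}\mu(\mathrm{d}b)}{\int_{\mathbb{R}}e^{bx-b^2t/2}\mu(\mathrm{d}b)}$, and let $\pi(t,x):=\mu_{t,x}([0,\infty))$. For each $t\ge0$ the map $x\mapsto\pi(t,x)$ is a strictly increasing continuous bijection from $\mathbb{R}$ onto $(0,1)$; its inverse is denoted $x(t,\cdot):(0,1)\to\mathbb{R}$. The volatility function is $\sigma(t,\pi):=\partial_2\pi(t,x(t,\pi))$ ($\partial_2$ is the derivative in the second argument of the function $\pi(\cdot,\cdot)$), equivalently $$\sigma(t,\pi)=(1-\pi)\int_{[0,\infty)}b\,\mu_{t,x(t,\pi)}(\mathrm{d}b)-\pi\int_{(-\infty,0)}b\,\mu_{t,x(t,\pi)}(\mathrm{d}b).$$ A two-point distribution is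 one of the form $(1-p)\delta_{a_1}+p\delta_{a_2}$ with $p\in(0,1)$; since $0<\mu([0,\infty))<1$, necessarily (after labelling) $a_1<0\le a_2$. *)

theory Defs
  imports "HOL-Probability.Probability"
begin

definition tilted_measure :: "real measure \<Rightarrow> real \<Rightarrow> real \<Rightarrow> real measure" where
  "tilted_measure \<mu> t x =
     density \<mu> (\<lambda>b. ennreal (exp (b * x - b\<^sup>2 * t / 2) / (\<integral>c. exp (c * x - c\<^sup>2 * t / 2) \<partial>\<mu>)))"

definition prob_nonneg :: "real measure \<Rightarrow> real \<Rightarrow> real \<Rightarrow> real" where
  "prob_nonneg \<mu> t x = measure (tilted_measure \<mu> t x) {0..}"

(* For t >= 0, and for \<mu> with 0 < \<mu>[0,\<infinity>) < 1 and a finite Gaussian moment, prob_nonneg \<mu> t is a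
   strictly increasing continuous bijection from the real line onto (0,1), so inv picks the unique
   preimage of any p in (0,1).  For other p the value is irrelevant. *)
definition prob_nonneg_inv :: "real measure \<Rightarrow> real \<Rightarrow> real \<Rightarrow> real" where
  "prob_nonneg_inv \<mu> t p = inv (prob_nonneg \<mu> t) p"

definition volatility :: "real measure \<Rightarrow> real \<Rightarrow> real \<Rightarrow> real" where
  "volatility \<mu> t p = deriv (prob_nonneg \<mu> t) (prob_nonneg_inv \<mu> t p)"

(* return borel a is the Dirac measure at a. *)
definition two_point_distribution :: "real measure \<Rightarrow> bool" where
  "two_point_distribution \<mu> \<longleftrightarrow> sets \<mu> = sets borel \<and>
     (\<exists>a\<^sub>1 a\<^sub>2 p. a\<^sub>1 \<noteq> a\<^sub>2 \<and> 0 < p \<and> p < 1 \<and>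
        (\<forall>A\<in>sets borel. emeasure \<mu> A =
           ennreal (1 - p) * emeasure (return borel a\<^sub>1) A + ennreal p * emeasure (return borel a\<^sub>2) A))"

end

theory Submission
  imports Defs
begin

text \<open>
  Fix \<open>\<pi>\<close> and \<open>s < t\<close>. The density of \<open>\<mu>\<^bsub>t,x(t,\<pi>)\<^esub>\<close> with respect to \<open>\<mu>\<^bsub>s,x(s,\<pi>)\<^esub>\<close> is \<open>exp q\<close> with \<open>q\<close> a
  concave quadratic polynomial. Both measures give the same mass to \<open>[0,\<infinity>)\<close> and to \<open>(-\<infinity>,0)\<close>, so \<open>q\<close> is nonnegative
  somewhere on each of these half-lines; hence it has roots \<open>r\<^sub>1 < 0 \<le> r\<^sub>2\<close>. Therefore
  \<open>(b - r\<^sub>2) (exp (q b) - 1) \<le> 0\<close> for \<open>b \<ge> 0\<close> and \<open>(b - r\<^sub>1) (exp (q b) - 1) \<ge> 0\<close> for \<open>b < 0\<close>: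
  passing from \<open>s\<close> to \<open>t\<close> moves both conditional means towards each other, and neither moves only if
  \<open>\<mu>\<close> is carried by \<open>{r\<^sub>1, r\<^sub>2}\<close>. Since \<open>\<sigma>\<close> is \<open>\<pi> (1 - \<pi>)\<close> times the difference of the conditional means,
  the claim follows.
\<close>

section \<open>Truncated moments and two elementary facts about real functions\<close>

text \<open>Leaving out the normalising integral makes differentiation in \<open>x\<close> simply
  raise \<open>k\<close> from 0 to 1, and turns both \<open>prob_nonneg\<close> and its derivative
  into ratios of such moments over the two half-lines.\<close>

definition tilt_moment :: "real measure \<Rightarrow> real set \<Rightarrow> nat \<Rightarrow> real \<Rightarrow> real \<Rightarrow> real" where
  "tilt_moment \<mu> S k t x = (\<integral>b. indicator S b * (b ^ k * exp (b * x - b\<^sup>2 * t / 2)) \<partial>\<mu>)"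

text \<open>A bound uniform in \<open>h\<close>, needed to differentiate under the integral sign. It
  follows from \<open>\<bar>exp u - 1\<bar> \<le> \<bar>u\<bar> * exp \<bar>u\<bar>\<close> at
  \<open>u = b * h\<close> and \<open>\<bar>b\<bar> \<le> exp \<bar>b\<bar>\<close>; for
  \<open>h = 0\<close> the quotient is 0 by convention.\<close>

lemma exp_diff_quotient_le:
  fixes b h :: real
  assumes "\<bar>h\<bar> \<le> 1"
  shows "\<bar>(exp (b * h) - 1) / h\<bar> \<le> exp (2 * \<bar>b\<bar>)"
proof (cases "h = 0")
  case False
  have "\<bar>exp u - 1\<bar> \<le> \<bar>u\<bar> * exp \<bar>u\<bar>" for u :: real
  proof -
    have a: "exp u - 1 \<le> u * exp u"
      using exp_ge_add_one_self[of "- u"] mult_right_mono[of "1 - u" "exp (-u)" "exp u"]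
      by (simp add: exp_minus algebra_simps)
    have b: "u \<le> exp u - 1" using exp_ge_add_one_self[of u] by linarith
    show ?thesis
    proof (cases "0 \<le> u")
      case True
      then show ?thesis using a b by simp
    next
      case False
      then have "exp u - 1 \<le> 0" by simp
      then have "\<bar>exp u - 1\<bar> \<le> \<bar>u\<bar> * 1" using b False by simp
      also have "\<dots> \<le> \<bar>u\<bar> * exp \<bar>u\<bar>" by (intro mult_left_mono) auto
      finally show ?thesis .
    qed
  qed
  from this[of "b * h"] have "\<bar>(exp (b * h) - 1) / h\<bar> \<le> \<bar>b\<bar> * exp (\<bar>b\<bar> * \<bar>h\<bar>)"
    using False by (simp add: abs_mult field_simps)
  also have "\<dots> \<le> exp \<bar>b\<bar> * exp \<bar>b\<bar>"
  proof (rule mult_mono)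
    show "\<bar>b\<bar> \<le> exp \<bar>b\<bar>" using exp_ge_add_one_self[of "\<bar>b\<bar>"] by linarith
    show "exp (\<bar>b\<bar> * \<bar>h\<bar>) \<le> exp \<bar>b\<bar>" using assms by (simp add: mult_left_le)
  qed auto
  finally show ?thesis by (simp flip: exp_add)
qed simp

text \<open>Completing the square writes the discriminant as \<open>4 * h\<close> times the value at
  \<open>b\<^sub>0\<close> plus a square, so it is nonnegative and the roots are real, possibly
  equal.\<close>

lemma concave_quadratic_factor:
  fixes h k d b\<^sub>0 :: real
  assumes h: "0 < h" and b0: "0 \<le> k + d * b\<^sub>0 - h * b\<^sub>0\<^sup>2"
  obtains r\<^sub>1 r\<^sub>2 where "r\<^sub>1 \<le> r\<^sub>2" "\<And>b. k + d * b - h * b\<^sup>2 = - h * ((b - r\<^sub>1) * (b - r\<^sub>2))"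
proof -
  define D where "D = d\<^sup>2 + 4 * h * k"
  have "D = 4 * h * (k + d * b\<^sub>0 - h * b\<^sub>0\<^sup>2) + (2 * h * b\<^sub>0 - d)\<^sup>2"
    by (simp add: D_def power2_eq_square algebra_simps)
  then have D: "0 \<le> D" using h b0 by simp
  define r\<^sub>1 r\<^sub>2 where "r\<^sub>1 = (d - sqrt D) / (2 * h)" and "r\<^sub>2 = (d + sqrt D) / (2 * h)"
  have sum: "h * (r\<^sub>1 + r\<^sub>2) = d"
    using h by (simp add: r\<^sub>1_def r\<^sub>2_def field_simps)
  have "r\<^sub>1 * r\<^sub>2 = (d\<^sup>2 - (sqrt D)\<^sup>2) / (4 * h\<^sup>2)"
    by (simp add: r\<^sub>1_def r\<^sub>2_def power2_eq_square algebra_simps)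
  also have "\<dots> = - (4 * h * k) / (4 * h\<^sup>2)"
    using D by (simp add: D_def)
  finally have prod: "h * (r\<^sub>1 * r\<^sub>2) = - k"
    using h by (simp add: power2_eq_square)
  show ?thesis
  proof (rule that)
    show "r\<^sub>1 \<le> r\<^sub>2"
      unfolding r\<^sub>1_def r\<^sub>2_def using h D by (intro divide_right_mono) auto
    show "k + d * b - h * b\<^sup>2 = - h * ((b - r\<^sub>1) * (b - r\<^sub>2))" for b
      using prod by (simp add: power2_eq_square algebra_simps flip: sum)
  qed
qed

section \<open>Integrability and differentiation under the integral sign\<close>

locale gaussian_moment = prob_space \<mu> for \<mu> :: "real measure" +
  fixes \<epsilon> :: real
  assumes sets_eq [measurable_cong, simp]: "sets \<mu> = sets borel"
    and eps_pos: "0 < \<epsilon>"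
    and gaussian_integrable: "integrable \<mu> (\<lambda>b. exp (\<epsilon> * b\<^sup>2))"
    and measure_nonneg_pos: "0 < measure \<mu> {0..}"
    and measure_nonneg_less_1: "measure \<mu> {0..} < 1"
begin

lemma space_eq [simp]: "space \<mu> = UNIV"
  using sets_eq_imp_space_eq[OF sets_eq] by simp

text \<open>Completing the square bounds \<open>\<bar>b\<bar> * X\<close> by
  \<open>\<epsilon> * b\<^sup>2\<close> plus a constant, so the Gaussian moment dominates every
  exponential moment.\<close>

lemma integrable_exp_abs: "integrable \<mu> (\<lambda>b. exp (\<bar>b\<bar> * X))"
proof (rule Bochner_Integration.integrable_bound)
  show "integrable \<mu> (\<lambda>b. exp (X\<^sup>2 / (4 * \<epsilon>)) * exp (\<epsilon> * b\<^sup>2))"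
    using gaussian_integrable by simp
  have "\<bar>b\<bar> * X \<le> X\<^sup>2 / (4 * \<epsilon>) + \<epsilon> * b\<^sup>2" for b
  proof -
    have "0 \<le> \<epsilon> * (\<bar>b\<bar> - X / (2 * \<epsilon>))\<^sup>2" using eps_pos by simp
    also have "\<dots> = X\<^sup>2 / (4 * \<epsilon>) + \<epsilon> * b\<^sup>2 - \<bar>b\<bar> * X"
      using eps_pos by (simp add: power2_eq_square field_simps)
    finally show ?thesis by simp
  qed
  then show "AE b in \<mu>. norm (exp (\<bar>b\<bar> * X)) \<le> norm (exp (X\<^sup>2 / (4 * \<epsilon>)) * exp (\<epsilon> * b\<^sup>2))"
    by (simp flip: exp_add)
qed measurable

text \<open>The power is at most \<open>exp (\<bar>b\<bar> * real k)\<close>, and the Gaussian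
  factor is at most 1 because \<open>t\<close> is nonnegative; an exponential moment of rate
  \<open>real k + \<bar>x\<bar>\<close> therefore dominates.\<close>

lemma tilt_integrable:
  assumes "0 \<le> t" and [measurable]: "S \<in> sets borel"
  shows "integrable \<mu> (\<lambda>b. indicator S b * (b ^ k * exp (b * x - b\<^sup>2 * t / 2)))"
proof (rule Bochner_Integration.integrable_bound[OF integrable_exp_abs[of "real k + \<bar>x\<bar>"]])
  have "norm (indicator S b * (b ^ k * exp (b * x - b\<^sup>2 * t / 2))) \<le> norm (exp (\<bar>b\<bar> * (real k + \<bar>x\<bar>)))" for b
  proof -
    have "\<bar>b\<bar> \<le> exp \<bar>b\<bar>" using exp_ge_add_one_self[of "\<bar>b\<bar>"] by linarith
    then have "\<bar>b\<bar> ^ k \<le> exp \<bar>b\<bar> ^ k" by (rule power_mono) simp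
    also have "\<dots> = exp (\<bar>b\<bar> * real k)" by (simp add: exp_of_nat2_mult)
    finally have 1: "\<bar>b\<bar> ^ k \<le> exp (\<bar>b\<bar> * real k)" .
    have "b * x \<le> \<bar>b\<bar> * \<bar>x\<bar>" by (metis abs_ge_self abs_mult)
    moreover have "0 \<le> b\<^sup>2 * t / 2" using assms by simp
    ultimately have 2: "exp (b * x - b\<^sup>2 * t / 2) \<le> exp (\<bar>b\<bar> * \<bar>x\<bar>)" by simp
    have "\<bar>b\<bar> ^ k * exp (b * x - b\<^sup>2 * t / 2) \<le> exp (\<bar>b\<bar> * real k) * exp (\<bar>b\<bar> * \<bar>x\<bar>)"
      using 1 2 by (intro mult_mono) auto
    also have "\<dots> = exp (\<bar>b\<bar> * (real k + \<bar>x\<bar>))" by (simp add: distrib_left exp_add)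
    finally show ?thesis by (auto simp: indicator_def abs_mult power_abs)
  qed
  then show "AE b in \<mu>. norm (indicator S b * (b ^ k * exp (b * x - b\<^sup>2 * t / 2)))
      \<le> norm (exp (\<bar>b\<bar> * (real k + \<bar>x\<bar>)))" by simp
qed measurable

text \<open>Dominated convergence for the difference quotients along an arbitrary null sequence
  \<open>H\<close> of nonzero increments.\<close>

lemma tilt_moment_has_derivative:
  assumes t: "0 \<le> t" and S [measurable]: "S \<in> sets borel"
  shows "(tilt_moment \<mu> S 0 t has_real_derivative tilt_moment \<mu> S 1 t x) (at x)"
  unfolding has_field_derivative_def DERIV_def
proof -
  let ?w = "\<lambda>b. exp (b * x - b\<^sup>2 * t / 2)"
  have "((\<lambda>h. (tilt_moment \<mu> S 0 t (x + h) - tilt_moment \<mu> S 0 t x) / h) \<longlongrightarrow> tilt_moment \<mu> S 1 t x) (at 0)"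
    unfolding tendsto_at_iff_sequentially comp_def
  proof safe
    fix H :: "nat \<Rightarrow> real"
    assume H: "\<forall>i. H i \<in> UNIV - {0}" and lim: "H \<longlonglongrightarrow> 0"
    have "eventually (\<lambda>i. \<bar>H i\<bar> < 1) sequentially"
      using order_tendstoD(2)[OF tendsto_rabs_zero[OF lim], of 1] by simp
    \<comment> \<open>The domination requires increments of absolute value at most 1, which is
      guaranteed only from \<open>N\<close> on; the sequence is shifted by \<open>N\<close> and the
      shift undone at the end.\<close>
    then obtain N where N: "\<And>i. i \<ge> N \<Longrightarrow> \<bar>H i\<bar> \<le> 1"
      by (auto simp: eventually_sequentially intro: less_imp_le)
    let ?f = "\<lambda>i b. indicator S b * (?w b * ((exp (b * H i) - 1) / H i))"
    have quot: "(tilt_moment \<mu> S 0 t (x + H i) - tilt_moment \<mu> S 0 t x) / H i = (\<integral>b. ?f i b \<partial>\<mu>)" for i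
    proof -
      have "(tilt_moment \<mu> S 0 t (x + H i) - tilt_moment \<mu> S 0 t x) / H i
        = (\<integral>b. (indicator S b * (b ^ 0 * exp (b * (x + H i) - b\<^sup>2 * t / 2))
              - indicator S b * (b ^ 0 * ?w b)) / H i \<partial>\<mu>)"
        unfolding tilt_moment_def
        by (simp only: integral_divide_zero Bochner_Integration.integral_diff[OF tilt_integrable[OF t S] tilt_integrable[OF t S]])
      also have "\<dots> = (\<integral>b. ?f i b \<partial>\<mu>)"
      proof (rule Bochner_Integration.integral_cong[OF refl])
        fix b
        have "exp (b * (x + H i) - b\<^sup>2 * t / 2) = ?w b * exp (b * H i)"
          by (simp add: algebra_simps flip: exp_add)
        then show "(indicator S b * (b ^ 0 * exp (b * (x + H i) - b\<^sup>2 * t / 2))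
              - indicator S b * (b ^ 0 * ?w b)) / H i = ?f i b"
          by (simp add: algebra_simps diff_divide_distrib)
      qed
      finally show ?thesis .
    qed
    have "(\<lambda>i. \<integral>b. ?f (i + N) b \<partial>\<mu>) \<longlonglongrightarrow> (\<integral>b. indicator S b * (b ^ 1 * ?w b) \<partial>\<mu>)"
    \<comment> \<open>The 2 bounds the difference quotient, and \<open>\<bar>x\<bar>\<close> bounds
      the weight at \<open>x\<close>.\<close>
    proof (rule integral_dominated_convergence[where w = "\<lambda>b. exp (\<bar>b\<bar> * (2 + \<bar>x\<bar>))"])
      show "AE b in \<mu>. (\<lambda>i. ?f (i + N) b) \<longlonglongrightarrow> indicator S b * (b ^ 1 * ?w b)"
      proof (rule AE_I2)
        fix b
        have "((\<lambda>h. exp (b * h)) has_real_derivative b) (at 0)"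
          by (auto intro!: derivative_eq_intros)
        then have "((\<lambda>h. (exp (b * h) - 1) / h) \<longlongrightarrow> b) (at 0)"
          by (simp add: DERIV_def)
        then have "(\<lambda>i. (exp (b * H i) - 1) / H i) \<longlonglongrightarrow> b"
          using H lim unfolding tendsto_at_iff_sequentially comp_def by blast
        then have "(\<lambda>i. (exp (b * H (i + N)) - 1) / H (i + N)) \<longlonglongrightarrow> b"
          by (rule LIMSEQ_ignore_initial_segment)
        then have "(\<lambda>i. ?f (i + N) b) \<longlonglongrightarrow> indicator S b * (?w b * b)"
          by (intro tendsto_intros)
        then show "(\<lambda>i. ?f (i + N) b) \<longlonglongrightarrow> indicator S b * (b ^ 1 * ?w b)"
          by (simp add: mult.commute)
      qed
      show "AE b in \<mu>. norm (?f (i + N) b) \<le> exp (\<bar>b\<bar> * (2 + \<bar>x\<bar>))" for i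
      proof (rule AE_I2)
        fix b
        have q: "\<bar>(exp (b * H (i + N)) - 1) / H (i + N)\<bar> \<le> exp (2 * \<bar>b\<bar>)"
          by (intro exp_diff_quotient_le N) simp
        have "b * x \<le> \<bar>b\<bar> * \<bar>x\<bar>" by (metis abs_ge_self abs_mult)
        moreover have "0 \<le> b\<^sup>2 * t / 2" using t by simp
        ultimately have w: "?w b \<le> exp (\<bar>b\<bar> * \<bar>x\<bar>)" by simp
        have "?w b * \<bar>(exp (b * H (i + N)) - 1) / H (i + N)\<bar> \<le> exp (\<bar>b\<bar> * \<bar>x\<bar>) * exp (2 * \<bar>b\<bar>)"
          by (rule mult_mono[OF w q]) auto
        also have "\<dots> = exp (\<bar>b\<bar> * (2 + \<bar>x\<bar>))"
          by (simp add: algebra_simps flip: exp_add)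
        finally show "norm (?f (i + N) b) \<le> exp (\<bar>b\<bar> * (2 + \<bar>x\<bar>))"
          by (auto simp: indicator_def abs_mult)
      qed
    qed (use integrable_exp_abs in \<open>measurable; simp\<close>)+
    then have "(\<lambda>i. \<integral>b. ?f i b \<partial>\<mu>) \<longlonglongrightarrow> tilt_moment \<mu> S 1 t x"
      unfolding tilt_moment_def by (rule LIMSEQ_offset)
    then show "(\<lambda>i. (tilt_moment \<mu> S 0 t (x + H i) - tilt_moment \<mu> S 0 t x) / H i) \<longlonglongrightarrow> tilt_moment \<mu> S 1 t x"
      by (simp only: quot)
  qed
  then show "(tilt_moment \<mu> S 0 t has_derivative (*) (tilt_moment \<mu> S 1 t x)) (at x)"
    by (simp add: DERIV_def flip: has_field_derivative_def)
qed

text \<open>The strictness claims below rest on this: if a strict inequality failed, some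
  nonnegative integrand would have integral at most 0 and hence vanish almost everywhere on
  \<open>S\<close>; where it has no zero on \<open>S\<close>, the set \<open>S\<close> is
  null.\<close>

lemma integral_null_AE:
  fixes f :: "real \<Rightarrow> real"
  assumes S [measurable]: "S \<in> sets borel"
    and int: "integrable \<mu> (\<lambda>b. indicator S b * f b)"
    and nonneg: "\<And>b. b \<in> S \<Longrightarrow> 0 \<le> f b"
    and le: "(\<integral>b. indicator S b * f b \<partial>\<mu>) \<le> 0"
  shows "AE b in \<mu>. b \<in> S \<longrightarrow> f b = 0"
proof -
  have nn: "0 \<le> indicator S b * f b" for b
    using nonneg by (auto simp: indicator_def)
  then have "(\<integral>b. indicator S b * f b \<partial>\<mu>) = 0"
    using le by (intro antisym integral_nonneg_AE) auto
  then have "AE b in \<mu>. indicator S b * f b = 0"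
    using integral_nonneg_eq_0_iff_AE[OF int] nn by simp
  then show ?thesis by eventually_elim (auto simp: indicator_def)
qed


section \<open>Positivity of the moments, and the probability of the nonnegative half-line as their
  ratio\<close>

lemma measure_neg_pos: "0 < measure \<mu> {..<0}"
proof -
  have "{..<0} = space \<mu> - {0..}" by auto
  then show ?thesis using prob_compl[of "{0..}"] measure_nonneg_less_1 by simp
qed

lemma tilt_moment_pos:
  assumes t: "0 \<le> t" and S [measurable]: "S \<in> sets borel" and pos: "0 < measure \<mu> S"
  shows "0 < tilt_moment \<mu> S 0 t x"
proof (rule ccontr)
  assume "\<not> 0 < tilt_moment \<mu> S 0 t x"
  then have "AE b in \<mu>. b \<in> S \<longrightarrow> b ^ 0 * exp (b * x - b\<^sup>2 * t / 2) = 0"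
    using tilt_integrable[OF t S, of 0 x] unfolding tilt_moment_def
    by (intro integral_null_AE) auto
  then have "AE b in \<mu>. b \<notin> S" by simp
  then have "measure \<mu> S = 0"
    by (intro measure_eq_0_null_sets) (simp add: AE_iff_null_sets)
  then show False using pos by simp
qed

lemmas tilt_moment_nonneg_pos = tilt_moment_pos[OF _ _ measure_nonneg_pos, simplified]
lemmas tilt_moment_neg_pos = tilt_moment_pos[OF _ _ measure_neg_pos, simplified]

lemma tilt_normalization:
  assumes t: "0 \<le> t"
  shows "(\<integral>b. exp (b * x - b\<^sup>2 * t / 2) \<partial>\<mu>) = tilt_moment \<mu> {0..} 0 t x + tilt_moment \<mu> {..<0} 0 t x"
  unfolding tilt_moment_def
  by (subst Bochner_Integration.integral_add[OF tilt_integrable[OF t] tilt_integrable[OF t], symmetric])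
    (auto simp: indicator_def intro!: Bochner_Integration.integral_cong)

lemma prob_nonneg_eq:
  assumes t: "0 \<le> t"
  shows "prob_nonneg \<mu> t x =
    tilt_moment \<mu> {0..} 0 t x / (tilt_moment \<mu> {0..} 0 t x + tilt_moment \<mu> {..<0} 0 t x)"
proof -
  define Z where "Z = tilt_moment \<mu> {0..} 0 t x + tilt_moment \<mu> {..<0} 0 t x"
  have Z: "0 < Z" unfolding Z_def
    by (intro add_pos_pos tilt_moment_nonneg_pos tilt_moment_neg_pos t)
  let ?d = "\<lambda>b. exp (b * x - b\<^sup>2 * t / 2) / Z"
  have "prob_nonneg \<mu> t x = (\<integral>b. indicator {0..} b \<partial>density \<mu> (\<lambda>b. ennreal (?d b)))"
    unfolding prob_nonneg_def tilted_measure_def tilt_normalization[OF t] Z_def[symmetric]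
    by simp
  also have "\<dots> = (\<integral>b. ?d b *\<^sub>R indicator {0..} b \<partial>\<mu>)"
    using Z by (intro integral_density) auto
  also have "\<dots> = (\<integral>b. (indicator {0..} b * (b ^ 0 * exp (b * x - b\<^sup>2 * t / 2))) / Z \<partial>\<mu>)"
    by (intro Bochner_Integration.integral_cong) auto
  also have "\<dots> = tilt_moment \<mu> {0..} 0 t x / Z"
    unfolding tilt_moment_def by (rule integral_divide_zero)
  finally show ?thesis by (simp add: Z_def)
qed

text \<open>Quotient rule for \<open>A / (A + B)\<close>, whose numerator collapses to
  \<open>A' * B - A * B'\<close>. Factoring out \<open>A * B\<close> shows this to be
  \<open>\<pi> * (1 - \<pi>)\<close> times the difference of the conditional means
  \<open>A' / A\<close> and \<open>B' / B\<close>.\<close>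

lemma prob_nonneg_has_derivative:
  assumes t: "0 \<le> t"
  shows "(prob_nonneg \<mu> t has_real_derivative
    (tilt_moment \<mu> {0..} 1 t x * tilt_moment \<mu> {..<0} 0 t x
      - tilt_moment \<mu> {0..} 0 t x * tilt_moment \<mu> {..<0} 1 t x)
    / (tilt_moment \<mu> {0..} 0 t x + tilt_moment \<mu> {..<0} 0 t x)\<^sup>2) (at x)"
proof -
  have *: "tilt_moment \<mu> {0..} 0 t x + tilt_moment \<mu> {..<0} 0 t x \<noteq> 0"
    using tilt_moment_nonneg_pos[OF t, of x] tilt_moment_neg_pos[OF t, of x] by linarith
  show ?thesis
    unfolding prob_nonneg_eq[OF t, abs_def]
    by (rule derivative_eq_intros tilt_moment_has_derivative[OF t] refl * | simp)+
       (simp add: power2_eq_square algebra_simps)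
qed

section \<open>Monotonicity in the space variable and surjectivity onto the open unit
  interval\<close>

text \<open>Only weak monotonicity can be claimed: if all the mass of \<open>{0..}\<close> sits at
  0, this moment does not depend on \<open>x\<close>. Strictness has to come from the negative
  half-line.\<close>

lemma tilt_moment_nonneg_mono:
  assumes t: "0 \<le> t" and "x \<le> y"
  shows "tilt_moment \<mu> {0..} 0 t x \<le> tilt_moment \<mu> {0..} 0 t y"
  unfolding tilt_moment_def
  by (intro integral_mono tilt_integrable t)
    (use assms in \<open>auto simp: indicator_def intro: mult_left_mono\<close>)

lemma tilt_moment_neg_strict_antimono:
  assumes t: "0 \<le> t" and "x < y"
  shows "tilt_moment \<mu> {..<0} 0 t y < tilt_moment \<mu> {..<0} 0 t x"
proof (rule ccontr)
  let ?w = "\<lambda>x b. b ^ 0 * exp (b * x - b\<^sup>2 * t / 2) :: real"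
  assume *: "\<not> tilt_moment \<mu> {..<0} 0 t y < tilt_moment \<mu> {..<0} 0 t x"
  have int: "integrable \<mu> (\<lambda>b. indicator {..<0} b * (?w x b - ?w y b))"
    using Bochner_Integration.integrable_diff[OF tilt_integrable[OF t, of "{..<0}" 0 x] tilt_integrable[OF t, of "{..<0}" 0 y]]
    by (simp add: right_diff_distrib)
  have "(\<integral>b. indicator {..<0} b * (?w x b - ?w y b) \<partial>\<mu>) = tilt_moment \<mu> {..<0} 0 t x - tilt_moment \<mu> {..<0} 0 t y"
    unfolding tilt_moment_def
    by (subst Bochner_Integration.integral_diff[OF tilt_integrable[OF t] tilt_integrable[OF t], symmetric])
      (simp_all add: right_diff_distrib)
  then have "AE b in \<mu>. b \<in> {..<0} \<longrightarrow> ?w x b - ?w y b = 0"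
    using * assms by (intro integral_null_AE[OF _ int]) (auto simp: mult_left_mono_neg)
  then have "AE b in \<mu>. b \<notin> {..<0}"
    by eventually_elim (use assms in auto)
  then have "measure \<mu> {..<0} = 0"
    by (intro measure_eq_0_null_sets) (simp add: AE_iff_null_sets)
  then show False using measure_neg_pos by simp
qed

text \<open>The ratio \<open>A / (A + B)\<close> increases with \<open>A / B\<close>; here
  \<open>A\<close> grows weakly and \<open>B\<close> decreases strictly, which is compared after
  cross-multiplication.\<close>

lemma prob_nonneg_strict_mono:
  assumes t: "0 \<le> t"
  shows "strict_mono (prob_nonneg \<mu> t)"
proof (rule strict_monoI)
  fix x y :: real assume xy: "x < y"
  note tilt_moment_nonneg_pos[OF t, of x] tilt_moment_neg_pos[OF t, of x]
    tilt_moment_nonneg_pos[OF t, of y] tilt_moment_neg_pos[OF t, of y]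
  moreover note tilt_moment_nonneg_mono[OF t less_imp_le[OF xy]] tilt_moment_neg_strict_antimono[OF t xy]
  ultimately have "tilt_moment \<mu> {0..} 0 t x * tilt_moment \<mu> {..<0} 0 t y
      < tilt_moment \<mu> {0..} 0 t y * tilt_moment \<mu> {..<0} 0 t x"
    by (intro mult_le_less_imp_less) auto
  then show "prob_nonneg \<mu> t x < prob_nonneg \<mu> t y"
    unfolding prob_nonneg_eq[OF t]
    by (simp add: pos_divide_less_eq pos_less_divide_eq add_pos_pos tilt_moment_nonneg_pos[OF t]
        tilt_moment_neg_pos[OF t] algebra_simps)
qed

text \<open>For negative \<open>b\<close> the integrand decays geometrically in \<open>n\<close> and
  is dominated by its value at \<open>n = 0\<close>. This supplies the upper point for the
  intermediate value theorem.\<close>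

lemma tilt_moment_neg_tendsto_0:
  assumes t: "0 \<le> t"
  shows "(\<lambda>n. tilt_moment \<mu> {..<0} 0 t (real n)) \<longlonglongrightarrow> 0"
proof -
  let ?f = "\<lambda>x b. indicator {..<0} b * (b ^ 0 * exp (b * x - b\<^sup>2 * t / 2)) :: real"
  have "(\<lambda>n. \<integral>b. ?f (real n) b \<partial>\<mu>) \<longlonglongrightarrow> (\<integral>b. 0 \<partial>\<mu>)"
  proof (rule integral_dominated_convergence[where w = "?f 0"])
    show "AE b in \<mu>. (\<lambda>n. ?f (real n) b) \<longlonglongrightarrow> 0"
    proof (rule AE_I2)
      fix b :: real
      show "(\<lambda>n. ?f (real n) b) \<longlonglongrightarrow> 0"
      proof (cases "b < 0")
        case True
        have "(\<lambda>n. exp (- (b\<^sup>2 * t / 2)) * exp b ^ n) \<longlonglongrightarrow> exp (- (b\<^sup>2 * t / 2)) * 0"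
          using True by (intro tendsto_intros LIMSEQ_realpow_zero) auto
        moreover have "exp (- (b\<^sup>2 * t / 2)) * exp b ^ n = exp (b * real n - b\<^sup>2 * t / 2)" for n
          by (simp add: exp_of_nat2_mult[symmetric] flip: exp_add)
        ultimately show ?thesis
          using True by simp
      qed simp
    qed
    show "AE b in \<mu>. norm (?f (real n) b) \<le> ?f 0 b" for n
      by (rule AE_I2) (auto simp: indicator_def mult_nonpos_nonneg)
    show "integrable \<mu> (?f 0)" by (rule tilt_integrable[OF t]) simp
  qed measurable
  then show ?thesis by (simp add: tilt_moment_def)
qed

text \<open>Integrates \<open>1 + b * x \<le> exp (b * x)\<close> against the Gaussian weight. Since
  the first moment over the negative half-line is negative, the bound grows without limit as
  \<open>x\<close> decreases, which yields an explicit lower point for the intermediate value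
  theorem.\<close>

lemma tilt_moment_neg_ge_linear:
  assumes t: "0 \<le> t"
  shows "tilt_moment \<mu> {..<0} 0 t 0 + x * tilt_moment \<mu> {..<0} 1 t 0 \<le> tilt_moment \<mu> {..<0} 0 t x"
proof -
  let ?w = "\<lambda>b. exp (b * 0 - b\<^sup>2 * t / 2) :: real"
  have "tilt_moment \<mu> {..<0} 0 t 0 + x * tilt_moment \<mu> {..<0} 1 t 0
    = (\<integral>b. indicator {..<0} b * (b ^ 0 * ?w b) + x * (indicator {..<0} b * (b ^ 1 * ?w b)) \<partial>\<mu>)"
    unfolding tilt_moment_def
    by (subst Bochner_Integration.integral_add) (auto intro!: tilt_integrable[OF t, of _ 0 0, simplified] tilt_integrable[OF t, of _ 1 0, simplified])
  also have "\<dots> \<le> tilt_moment \<mu> {..<0} 0 t x"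
    unfolding tilt_moment_def
  proof (rule integral_mono)
    fix b :: real
    have "(1 + b * x) * ?w b \<le> exp (b * x) * ?w b"
      by (intro mult_right_mono exp_ge_add_one_self) auto
    then show "indicator {..<0} b * (b ^ 0 * ?w b) + x * (indicator {..<0} b * (b ^ 1 * ?w b))
      \<le> indicator {..<0} b * (b ^ 0 * exp (b * x - b\<^sup>2 * t / 2))"
      by (auto simp: indicator_def algebra_simps simp flip: exp_add)
  qed (intro Bochner_Integration.integrable_add integrable_mult_right tilt_integrable[OF t]; simp)+
  finally show ?thesis .
qed

lemma tilt_moment_neg_1_neg:
  assumes t: "0 \<le> t"
  shows "tilt_moment \<mu> {..<0} 1 t x < 0"
proof (rule ccontr)
  assume *: "\<not> tilt_moment \<mu> {..<0} 1 t x < 0"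
  let ?w = "\<lambda>b. - (b ^ 1 * exp (b * x - b\<^sup>2 * t / 2)) :: real"
  have int: "integrable \<mu> (\<lambda>b. indicator {..<0} b * ?w b)"
    using tilt_integrable[OF t, of "{..<0}" 1 x] by simp
  have "AE b in \<mu>. b \<in> {..<0} \<longrightarrow> ?w b = 0"
    using * by (intro integral_null_AE[OF _ int]) (auto simp: tilt_moment_def mult_nonpos_nonneg)
  then have "AE b in \<mu>. b \<notin> {..<0}"
    by eventually_elim auto
  then have "measure \<mu> {..<0} = 0"
    by (intro measure_eq_0_null_sets) (simp add: AE_iff_null_sets)
  then show False using measure_neg_pos by simp
qed

text \<open>Intermediate value theorem between an explicit \<open>a \<le> 0\<close> and a large
  integer. Clearing denominators turns both endpoint conditions into comparisons of
  \<open>?A x * (1 - p)\<close> with \<open>p * ?B x\<close>.\<close>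

lemma prob_nonneg_attains:
  assumes t: "0 \<le> t" and p: "0 < p" "p < 1"
  obtains x where "prob_nonneg \<mu> t x = p"
proof -
  let ?A = "tilt_moment \<mu> {0..} 0 t" and ?B = "tilt_moment \<mu> {..<0} 0 t"
  note pos = tilt_moment_nonneg_pos[OF t] tilt_moment_neg_pos[OF t]
  have le_iff: "prob_nonneg \<mu> t x \<le> p \<longleftrightarrow> ?A x * (1 - p) \<le> p * ?B x"
    and ge_iff: "p \<le> prob_nonneg \<mu> t x \<longleftrightarrow> p * ?B x \<le> ?A x * (1 - p)" for x
    unfolding prob_nonneg_eq[OF t] using pos[of x]
    by (simp_all add: pos_divide_le_eq pos_le_divide_eq add_pos_pos algebra_simps)
  define m where "m = - tilt_moment \<mu> {..<0} 1 t 0"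
  have m: "0 < m" using tilt_moment_neg_1_neg[OF t, of 0] by (simp add: m_def)
  \<comment> \<open>Chosen so that \<open>p * (- a * m)\<close> equals
    \<open>?A 0 * (1 - p)\<close>; then the linear lower bound for \<open>?B a\<close> is already
    large enough.\<close>
  define a where "a = - (?A 0 * (1 - p) / (p * m))"
  have a: "a \<le> 0" using p m pos(1)[of 0] by (simp add: a_def)
  have "?A a * (1 - p) \<le> ?A 0 * (1 - p)"
    using tilt_moment_nonneg_mono[OF t a] p by (intro mult_right_mono) auto
  also have "\<dots> = p * (- a * m)" using p m by (simp add: a_def)
  also have "\<dots> \<le> p * ?B a"
    using tilt_moment_neg_ge_linear[OF t, of a] pos(2)[of 0] p
    by (intro mult_left_mono) (auto simp: m_def)
  finally have lo: "prob_nonneg \<mu> t a \<le> p" by (simp add: le_iff)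
  have "eventually (\<lambda>n. ?B (real n) < ?A 0 * (1 - p) / p) sequentially"
    using p pos(1)[of 0] by (intro order_tendstoD(2)[OF tilt_moment_neg_tendsto_0[OF t]]) auto
  then obtain n where n: "?B (real n) < ?A 0 * (1 - p) / p"
    by (auto simp: eventually_sequentially)
  then have "p * ?B (real n) \<le> ?A 0 * (1 - p)"
    using p by (simp add: field_simps)
  also have "\<dots> \<le> ?A (real n) * (1 - p)"
    using tilt_moment_nonneg_mono[OF t, of 0 "real n"] p by (intro mult_right_mono) auto
  finally have hi: "p \<le> prob_nonneg \<mu> t (real n)" by (simp add: ge_iff)
  have "isCont (prob_nonneg \<mu> t) x" for x
    using prob_nonneg_has_derivative[OF t] by (rule DERIV_isCont)
  then obtain x where "prob_nonneg \<mu> t x = p"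
    using IVT[of "prob_nonneg \<mu> t" a p "real n"] lo hi a by force
  then show ?thesis by (rule that)
qed

lemma prob_nonneg_inv:
  assumes "0 \<le> t" and "0 < p" "p < 1"
  shows "prob_nonneg \<mu> t (prob_nonneg_inv \<mu> t p) = p"
  unfolding prob_nonneg_inv_def
  using prob_nonneg_attains[OF assms] by (metis f_inv_into_f rangeI)

section \<open>Comparison of the volatility at two times\<close>

lemma volatility_eq:
  assumes t: "0 \<le> t" and x: "x = prob_nonneg_inv \<mu> t p"
  shows "volatility \<mu> t p =
    (tilt_moment \<mu> {0..} 1 t x * tilt_moment \<mu> {..<0} 0 t x
      - tilt_moment \<mu> {0..} 0 t x * tilt_moment \<mu> {..<0} 1 t x)
    / (tilt_moment \<mu> {0..} 0 t x + tilt_moment \<mu> {..<0} 0 t x)\<^sup>2"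
  unfolding volatility_def x by (rule DERIV_imp_deriv[OF prob_nonneg_has_derivative[OF t]])

text \<open>Here \<open>c\<close> stands for the ratio of the normalising constants, so the two
  equations say that the tilted measures at \<open>(s, x)\<close> and \<open>(t, y)\<close> agree on
  the mass of each half-line. The inequalities then compare conditional means, and the last two
  conclusions treat equality separately on each half-line.\<close>

lemma tilt_comparison:
  assumes s: "0 \<le> s" and st: "s < t" and c: "0 < c"
    and eq_nonneg: "c * tilt_moment \<mu> {0..} 0 t y = tilt_moment \<mu> {0..} 0 s x"
    and eq_neg: "c * tilt_moment \<mu> {..<0} 0 t y = tilt_moment \<mu> {..<0} 0 s x"
  obtains r\<^sub>1 r\<^sub>2 where "r\<^sub>1 < 0" "0 \<le> r\<^sub>2"
    and "c * tilt_moment \<mu> {0..} 1 t y \<le> tilt_moment \<mu> {0..} 1 s x"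
    and "tilt_moment \<mu> {..<0} 1 s x \<le> c * tilt_moment \<mu> {..<0} 1 t y"
    and "c * tilt_moment \<mu> {0..} 1 t y = tilt_moment \<mu> {0..} 1 s x \<Longrightarrow> AE b in \<mu>. b \<in> {0..} \<longrightarrow> b = r\<^sub>2"
    and "c * tilt_moment \<mu> {..<0} 1 t y = tilt_moment \<mu> {..<0} 1 s x \<Longrightarrow> AE b in \<mu>. b \<in> {..<0} \<longrightarrow> b = r\<^sub>1"
proof -
  have t: "0 \<le> t" using s st by simp
  define u where "u b = exp (b * x - b\<^sup>2 * s / 2)" for b
  \<comment> \<open>Difference of the rescaled densities. It has the sign of \<open>q\<close>, and
    by the two equations its integral over each half-line vanishes.\<close>
  define g where "g b = c * exp (b * y - b\<^sup>2 * t / 2) - u b" for b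
  define q where "q b = ln c + (y - x) * b - (t - s) / 2 * b\<^sup>2" for b
  have g_eq: "g b = u b * (exp (q b) - 1)" for b
  proof -
    have "c * exp (b * y - b\<^sup>2 * t / 2) = exp (ln c + (b * y - b\<^sup>2 * t / 2))"
      using c by (simp add: exp_add)
    also have "ln c + (b * y - b\<^sup>2 * t / 2) = (b * x - b\<^sup>2 * s / 2) + q b"
      by (simp add: q_def field_simps)
    finally have "c * exp (b * y - b\<^sup>2 * t / 2) = u b * exp (q b)"
      unfolding u_def exp_add .
    then show ?thesis by (simp add: g_def algebra_simps)
  qed
  have u: "0 < u b" for b by (simp add: u_def)
  have g_nonneg: "0 \<le> g b" if "0 \<le> q b" for b
    using that u[of b] by (simp add: g_eq)
  have g_nonpos: "g b \<le> 0" if "q b \<le> 0" for b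
    using that u[of b] by (simp add: g_eq mult_nonneg_nonpos)
  have g_0: "g b = 0 \<longleftrightarrow> q b = 0" for b
    using u[of b] by (simp add: g_eq)
  have g_split: "indicator S b * (b ^ k * g b) =
      c * (indicator S b * (b ^ k * exp (b * y - b\<^sup>2 * t / 2)))
      - indicator S b * (b ^ k * exp (b * x - b\<^sup>2 * s / 2))" for S k b
    by (simp add: g_def u_def algebra_simps)
  have g_int: "integrable \<mu> (\<lambda>b. indicator S b * (b ^ k * g b))" if "S \<in> sets borel" for S k
    unfolding g_split using that s t by (intro Bochner_Integration.integrable_diff integrable_mult_right tilt_integrable)
  have g_integral: "(\<integral>b. indicator S b * (b ^ k * g b) \<partial>\<mu>) = c * tilt_moment \<mu> S k t y - tilt_moment \<mu> S k s x"
    if "S \<in> sets borel" for S k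
    unfolding g_split tilt_moment_def using that s t
    by (subst Bochner_Integration.integral_diff) (auto intro!: tilt_integrable)
  \<comment> \<open>If \<open>q\<close> were negative on all of \<open>S\<close>, then
    \<open>g\<close> would be negative there with zero integral, making \<open>S\<close> a null
    set.\<close>
  have ex: "\<exists>b\<in>S. 0 \<le> q b"
    if S: "S \<in> sets borel" and pos: "0 < measure \<mu> S"
      and eq: "c * tilt_moment \<mu> S 0 t y = tilt_moment \<mu> S 0 s x" for S
  proof (rule ccontr)
    assume "\<not> (\<exists>b\<in>S. 0 \<le> q b)"
    then have neg: "q b < 0" if "b \<in> S" for b using that by force
    have "AE b in \<mu>. b \<in> S \<longrightarrow> - g b = 0"
      using g_int[OF S, of 0] g_integral[OF S, of 0] eq neg g_nonpos
      by (intro integral_null_AE[OF S]) (auto intro: less_imp_le)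
    then have "AE b in \<mu>. b \<notin> S"
      by eventually_elim (use neg g_0 in force)
    then have "measure \<mu> S = 0"
      using S by (intro measure_eq_0_null_sets) (simp add: AE_iff_null_sets)
    then show False using pos by simp
  qed
  obtain b\<^sub>1 where b1: "b\<^sub>1 < 0" "0 \<le> q b\<^sub>1"
    using ex[of "{..<0}"] measure_neg_pos eq_neg by auto
  obtain b\<^sub>2 where b2: "0 \<le> b\<^sub>2" "0 \<le> q b\<^sub>2"
    using ex[of "{0..}"] measure_nonneg_pos eq_nonneg by auto
  obtain r\<^sub>1 r\<^sub>2 where r12: "r\<^sub>1 \<le> r\<^sub>2" and q_eq: "\<And>b. q b = - ((t - s) / 2) * ((b - r\<^sub>1) * (b - r\<^sub>2))"
    using concave_quadratic_factor[of "(t - s) / 2" "ln c" "y - x" b\<^sub>1] st b1(2)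
    unfolding q_def by auto
  have q_nonneg: "0 \<le> q b \<longleftrightarrow> r\<^sub>1 \<le> b \<and> b \<le> r\<^sub>2" for b
  proof -
    have "0 \<le> q b \<longleftrightarrow> (b - r\<^sub>1) * (b - r\<^sub>2) \<le> 0"
      using st by (simp add: q_eq mult_le_0_iff zero_le_mult_iff)
    then show ?thesis using r12 by (auto simp: mult_le_0_iff)
  qed
  \<comment> \<open>The interval where \<open>q\<close> is nonnegative contains both
    \<open>b\<^sub>1 < 0\<close> and \<open>b\<^sub>2 \<ge> 0\<close>.\<close>
  have r1: "r\<^sub>1 < 0" and r2: "0 \<le> r\<^sub>2" using q_nonneg[of b\<^sub>1] q_nonneg[of b\<^sub>2] b1 b2 by auto
  have q_0: "q b = 0 \<longleftrightarrow> b = r\<^sub>1 \<or> b = r\<^sub>2" for b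
    using st by (simp add: q_eq)
  \<comment> \<open>As \<open>r\<^sub>1 < 0\<close>, the only sign change of \<open>g\<close> on
    this half-line is at \<open>r\<^sub>2\<close>; the negative half-line is symmetric with
    \<open>r\<^sub>1\<close>.\<close>
  have sgn_nonneg: "0 \<le> (r\<^sub>2 - b) * g b" if "b \<in> {0..}" for b
    using that q_nonneg[of b] r1 g_nonneg[of b] g_nonpos[of b]
    by (cases "b \<le> r\<^sub>2") (auto intro: mult_nonpos_nonpos)
  have sgn_neg: "0 \<le> (b - r\<^sub>1) * g b" if "b \<in> {..<0}" for b
    using that q_nonneg[of b] r2 g_nonneg[of b] g_nonpos[of b]
    by (cases "r\<^sub>1 \<le> b") (auto intro: mult_nonpos_nonpos)
  have shift: "indicator S b * ((r - b) * g b) = r * (indicator S b * (b ^ 0 * g b)) - indicator S b * (b ^ 1 * g b)" for S r b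
    by (simp add: algebra_simps)
  have shift_int: "integrable \<mu> (\<lambda>b. indicator S b * ((r - b) * g b))" if "S \<in> sets borel" for S r
    unfolding shift by (intro Bochner_Integration.integrable_diff integrable_mult_right g_int that)
  \<comment> \<open>The terms with \<open>r\<close> cancel because the zeroth moments over
    \<open>S\<close> agree. The integral is thus independent of \<open>r\<close>, and each half-line
    may use its own root.\<close>
  have shift_integral: "(\<integral>b. indicator S b * ((r - b) * g b) \<partial>\<mu>) = tilt_moment \<mu> S 1 s x - c * tilt_moment \<mu> S 1 t y"
    if S: "S \<in> sets borel" and eq: "c * tilt_moment \<mu> S 0 t y = tilt_moment \<mu> S 0 s x" for S r
    unfolding shift
    by (subst Bochner_Integration.integral_diff[OF integrable_mult_right[OF g_int[OF S]] g_int[OF S]])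
      (simp only: integral_mult_right_zero g_integral[OF S] eq, simp)
  have neg_flip: "indicator S b * ((b - r) * g b) = - (indicator S b * ((r - b) * g b))" for S r b
    by (simp add: algebra_simps)
  show ?thesis
  proof (rule that[OF r1 r2])
    have "0 \<le> (\<integral>b. indicator {0..} b * ((r\<^sub>2 - b) * g b) \<partial>\<mu>)"
      using sgn_nonneg by (intro integral_nonneg_AE AE_I2) (auto simp: indicator_def)
    then show "c * tilt_moment \<mu> {0..} 1 t y \<le> tilt_moment \<mu> {0..} 1 s x"
      by (simp add: shift_integral eq_nonneg)
    have "0 \<le> (\<integral>b. indicator {..<0} b * ((b - r\<^sub>1) * g b) \<partial>\<mu>)"
      using sgn_neg by (intro integral_nonneg_AE AE_I2) (auto simp: indicator_def)
    then show "tilt_moment \<mu> {..<0} 1 s x \<le> c * tilt_moment \<mu> {..<0} 1 t y"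
      unfolding neg_flip by (simp add: shift_integral eq_neg)
  next
    assume "c * tilt_moment \<mu> {0..} 1 t y = tilt_moment \<mu> {0..} 1 s x"
    then have "AE b in \<mu>. b \<in> {0..} \<longrightarrow> (r\<^sub>2 - b) * g b = 0"
      by (intro integral_null_AE shift_int sgn_nonneg) (simp_all add: shift_integral eq_nonneg)
    then show "AE b in \<mu>. b \<in> {0..} \<longrightarrow> b = r\<^sub>2"
      by eventually_elim (use r1 g_0 q_0 in auto)
  next
    assume "c * tilt_moment \<mu> {..<0} 1 t y = tilt_moment \<mu> {..<0} 1 s x"
    then have "AE b in \<mu>. b \<in> {..<0} \<longrightarrow> (b - r\<^sub>1) * g b = 0"
      using shift_int[of "{..<0}" r\<^sub>1]
      by (intro integral_null_AE sgn_neg; simp add: neg_flip shift_integral eq_neg)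
    then show "AE b in \<mu>. b \<in> {..<0} \<longrightarrow> b = r\<^sub>1"
      by eventually_elim (use r2 g_0 q_0 in auto)
  qed
qed

text \<open>Rescaling by \<open>c\<close> brings both volatilities to the same denominator, where
  \<open>tilt_comparison\<close> bounds the two terms of the numerator separately.\<close>

lemma volatility_antimono:
  assumes s: "0 \<le> s" and st: "s < t" and p: "0 < p" "p < 1"
  shows "volatility \<mu> t p \<le> volatility \<mu> s p"
    and "volatility \<mu> t p = volatility \<mu> s p \<Longrightarrow> \<exists>r\<^sub>1 r\<^sub>2. r\<^sub>1 < 0 \<and> 0 \<le> r\<^sub>2 \<and> (AE b in \<mu>. b = r\<^sub>1 \<or> b = r\<^sub>2)"
proof -
  have t: "0 \<le> t" using s st by simp
  define x where "x = prob_nonneg_inv \<mu> s p"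
  define y where "y = prob_nonneg_inv \<mu> t p"
  define As where "As = tilt_moment \<mu> {0..} 0 s x"
  define Bs where "Bs = tilt_moment \<mu> {..<0} 0 s x"
  define At where "At = tilt_moment \<mu> {0..} 0 t y"
  define Bt where "Bt = tilt_moment \<mu> {..<0} 0 t y"
  define As1 where "As1 = tilt_moment \<mu> {0..} 1 s x"
  define Bs1 where "Bs1 = tilt_moment \<mu> {..<0} 1 s x"
  define At1 where "At1 = tilt_moment \<mu> {0..} 1 t y"
  define Bt1 where "Bt1 = tilt_moment \<mu> {..<0} 1 t y"
  note defs = As_def Bs_def At_def Bt_def As1_def Bs1_def At1_def Bt1_def
  have pos: "0 < As" "0 < Bs" "0 < At" "0 < Bt"
    unfolding defs using tilt_moment_nonneg_pos tilt_moment_neg_pos s t by auto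
  \<comment> \<open>Ratio of the normalising constants at the two times. Since both give the same
    probability \<open>p\<close>, this \<open>c\<close> also matches the masses of the two
    half-lines.\<close>
  define c where "c = (As + Bs) / (At + Bt)"
  have c: "0 < c" using pos by (simp add: c_def)
  have "As / (As + Bs) = p" "At / (At + Bt) = p"
    using prob_nonneg_inv[OF s p] prob_nonneg_inv[OF t p]
    by (simp_all add: prob_nonneg_eq s t flip: x_def y_def defs)
  then have ps: "As = p * (As + Bs)" and pt: "At = p * (At + Bt)"
    using pos by (metis add_pos_pos less_irrefl nonzero_divide_eq_eq)+
  have cZ: "c * (At + Bt) = As + Bs" using pos by (simp add: c_def)
  have cA: "c * At = As" using cZ ps pt by (metis mult.left_commute)
  have cB: "c * Bt = Bs" using cA cZ by (simp add: algebra_simps)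
  have vs: "volatility \<mu> s p = (As1 * Bs - As * Bs1) / (As + Bs)\<^sup>2"
    by (simp add: volatility_eq[OF s x_def] defs)
  have "volatility \<mu> t p = (At1 * Bt - At * Bt1) / (At + Bt)\<^sup>2"
    by (simp add: volatility_eq[OF t y_def] defs)
  also have "\<dots> = (c\<^sup>2 * (At1 * Bt - At * Bt1)) / (c\<^sup>2 * (At + Bt)\<^sup>2)"
    using c by simp
  also have "c\<^sup>2 * (At1 * Bt - At * Bt1) = c * At1 * (c * Bt) - c * At * (c * Bt1)"
    by (simp add: power2_eq_square algebra_simps)
  also have "c\<^sup>2 * (At + Bt)\<^sup>2 = (As + Bs)\<^sup>2" by (simp add: cZ flip: power_mult_distrib)
  finally have vt: "volatility \<mu> t p = (c * At1 * Bs - As * (c * Bt1)) / (As + Bs)\<^sup>2"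
    unfolding cA cB .
  obtain r\<^sub>1 r\<^sub>2 where r: "r\<^sub>1 < 0" "0 \<le> r\<^sub>2"
    and le: "c * At1 \<le> As1" "Bs1 \<le> c * Bt1"
    and eqP: "c * At1 = As1 \<Longrightarrow> AE b in \<mu>. b \<in> {0..} \<longrightarrow> b = r\<^sub>2"
    and eqN: "c * Bt1 = Bs1 \<Longrightarrow> AE b in \<mu>. b \<in> {..<0} \<longrightarrow> b = r\<^sub>1"
    by (rule tilt_comparison[OF s st c cA[unfolded defs] cB[unfolded defs], folded defs]) (rule that; blast)
  have le': "c * At1 * Bs \<le> As1 * Bs" "As * Bs1 \<le> As * (c * Bt1)"
    using le pos by auto
  then show "volatility \<mu> t p \<le> volatility \<mu> s p"
    unfolding vs vt by (intro divide_right_mono) auto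
  assume "volatility \<mu> t p = volatility \<mu> s p"
  then have "c * At1 * Bs - As * (c * Bt1) = As1 * Bs - As * Bs1"
    using pos unfolding vs vt by auto
  \<comment> \<open>Two inequalities whose combination is an equality must both be
    equalities.\<close>
  then have "c * At1 * Bs = As1 * Bs" "As * (c * Bt1) = As * Bs1"
    using le' by linarith+
  then have "c * At1 = As1" "c * Bt1 = Bs1" using pos by auto
  from eqP[OF this(1)] eqN[OF this(2)] have "AE b in \<mu>. b = r\<^sub>1 \<or> b = r\<^sub>2"
    by eventually_elim auto
  with r show "\<exists>r\<^sub>1 r\<^sub>2. r\<^sub>1 < 0 \<and> 0 \<le> r\<^sub>2 \<and> (AE b in \<mu>. b = r\<^sub>1 \<or> b = r\<^sub>2)" by blast
qed

section \<open>The two-point case\<close>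

text \<open>Each half-line carries a single atom, so the conditional means are
  \<open>r\<^sub>1\<close> and \<open>r\<^sub>2\<close> under every tilt, and \<open>t\<close> drops
  out.\<close>

lemma two_point_volatility:
  assumes AE: "AE b in \<mu>. b = r\<^sub>1 \<or> b = r\<^sub>2" and r: "r\<^sub>1 < 0" "0 \<le> r\<^sub>2"
    and t: "0 \<le> t" and p: "0 < p" "p < 1"
  shows "volatility \<mu> t p = p * (1 - p) * (r\<^sub>2 - r\<^sub>1)"
proof -
  define x where "x = prob_nonneg_inv \<mu> t p"
  define A where "A = tilt_moment \<mu> {0..} 0 t x"
  define B where "B = tilt_moment \<mu> {..<0} 0 t x"
  have pos: "0 < A" "0 < B"
    unfolding A_def B_def using tilt_moment_nonneg_pos tilt_moment_neg_pos t by auto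
  have pA: "A / (A + B) = p"
    using prob_nonneg_inv[OF t p] by (simp add: prob_nonneg_eq t A_def B_def x_def)
  have pB: "B / (A + B) = 1 - p"
    using pos unfolding pA[symmetric] by (simp add: field_simps)
  have A1: "tilt_moment \<mu> {0..} 1 t x = r\<^sub>2 * A"
    unfolding A_def tilt_moment_def integral_mult_right_zero[symmetric]
  proof (rule integral_cong_AE)
    show "AE b in \<mu>. indicator {0..} b * (b ^ 1 * exp (b * x - b\<^sup>2 * t / 2))
        = r\<^sub>2 * (indicator {0..} b * (b ^ 0 * exp (b * x - b\<^sup>2 * t / 2)))"
      using AE by eventually_elim (use r in auto)
  qed measurable
  have B1: "tilt_moment \<mu> {..<0} 1 t x = r\<^sub>1 * B"
    unfolding B_def tilt_moment_def integral_mult_right_zero[symmetric]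
  proof (rule integral_cong_AE)
    show "AE b in \<mu>. indicator {..<0} b * (b ^ 1 * exp (b * x - b\<^sup>2 * t / 2))
        = r\<^sub>1 * (indicator {..<0} b * (b ^ 0 * exp (b * x - b\<^sup>2 * t / 2)))"
      using AE by eventually_elim (use r in auto)
  qed measurable
  have "volatility \<mu> t p = (r\<^sub>2 * A * B - A * (r\<^sub>1 * B)) / (A + B)\<^sup>2"
    unfolding volatility_eq[OF t x_def] A1 B1 by (simp only: A_def B_def)
  also have "\<dots> = A / (A + B) * (B / (A + B)) * (r\<^sub>2 - r\<^sub>1)"
    by (simp add: power2_eq_square algebra_simps diff_divide_distrib)
  finally show ?thesis by (simp only: pA pB)
qed

text \<open>Both half-lines have positive mass, so two atoms must lie on opposite sides of 0.
  Conversely, the weights of \<open>r\<^sub>1\<close> and \<open>r\<^sub>2\<close> are forced to be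
  the masses of the two half-lines.\<close>

lemma two_point_distribution_iff:
  "two_point_distribution \<mu> \<longleftrightarrow> (\<exists>r\<^sub>1 r\<^sub>2. r\<^sub>1 < 0 \<and> 0 \<le> r\<^sub>2 \<and> (AE b in \<mu>. b = r\<^sub>1 \<or> b = r\<^sub>2))"
proof
  assume "two_point_distribution \<mu>"
  then obtain a\<^sub>1 a\<^sub>2 p where em: "\<And>A. A \<in> sets borel \<Longrightarrow> emeasure \<mu> A =
      ennreal (1 - p) * indicator A a\<^sub>1 + ennreal p * indicator A a\<^sub>2"
    unfolding two_point_distribution_def by (auto simp: emeasure_return)
  have "emeasure \<mu> (- {a\<^sub>1, a\<^sub>2}) = 0" by (subst em) auto
  then have AE: "AE b in \<mu>. b = a\<^sub>1 \<or> b = a\<^sub>2"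
    by (intro AE_I[where N = "- {a\<^sub>1, a\<^sub>2}"]) auto
  have "a\<^sub>1 < 0 \<or> a\<^sub>2 < 0"
    using em[of "{..<0}"] measure_neg_pos by (cases "a\<^sub>1 < 0"; cases "a\<^sub>2 < 0") (auto simp: measure_def indicator_def)
  moreover have "0 \<le> a\<^sub>1 \<or> 0 \<le> a\<^sub>2"
    using em[of "{0..}"] measure_nonneg_pos by (cases "0 \<le> a\<^sub>1"; cases "0 \<le> a\<^sub>2") (auto simp: measure_def indicator_def)
  ultimately consider "a\<^sub>1 < 0" "0 \<le> a\<^sub>2" | "a\<^sub>2 < 0" "0 \<le> a\<^sub>1" by linarith
  then show "\<exists>r\<^sub>1 r\<^sub>2. r\<^sub>1 < 0 \<and> 0 \<le> r\<^sub>2 \<and> (AE b in \<mu>. b = r\<^sub>1 \<or> b = r\<^sub>2)"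
  proof cases
    case 1
    then show ?thesis using AE by blast
  next
    case 2
    have "AE b in \<mu>. b = a\<^sub>2 \<or> b = a\<^sub>1" using AE by eventually_elim auto
    then show ?thesis using 2 by blast
  qed
next
  assume "\<exists>r\<^sub>1 r\<^sub>2. r\<^sub>1 < 0 \<and> 0 \<le> r\<^sub>2 \<and> (AE b in \<mu>. b = r\<^sub>1 \<or> b = r\<^sub>2)"
  then obtain r\<^sub>1 r\<^sub>2 where r: "r\<^sub>1 < 0" "0 \<le> r\<^sub>2" and AE: "AE b in \<mu>. b = r\<^sub>1 \<or> b = r\<^sub>2" by blast
  define p where "p = measure \<mu> {0..}"
  have "{..<0} = space \<mu> - {0..}" by auto
  then have q: "measure \<mu> {..<0} = 1 - p" using prob_compl[of "{0..}"] by (simp add: p_def)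
  have em: "emeasure \<mu> A = ennreal (1 - p) * indicator A r\<^sub>1 + ennreal p * indicator A r\<^sub>2"
    if [measurable]: "A \<in> sets borel" for A
  proof -
    have "A = (A \<inter> {..<0}) \<union> (A \<inter> {0..})" by auto
    then have "emeasure \<mu> A = emeasure \<mu> (A \<inter> {..<0}) + emeasure \<mu> (A \<inter> {0..})"
      by (subst plus_emeasure) auto
    \<comment> \<open>All mass of the negative half-line sits at \<open>r\<^sub>1\<close>, so up to
      a null set \<open>A\<close> contains either the whole half-line or nothing of it.\<close>
    also have "emeasure \<mu> (A \<inter> {..<0}) = emeasure \<mu> (if r\<^sub>1 \<in> A then {..<0} else {})"
    proof (rule emeasure_eq_AE)
      show "AE b in \<mu>. b \<in> A \<inter> {..<0} \<longleftrightarrow> b \<in> (if r\<^sub>1 \<in> A then {..<0} else {})"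
        using AE by eventually_elim (use r in auto)
    qed auto
    also have "\<dots> = ennreal (1 - p) * indicator A r\<^sub>1"
      by (simp add: emeasure_eq_measure q)
    also have "emeasure \<mu> (A \<inter> {0..}) = emeasure \<mu> (if r\<^sub>2 \<in> A then {0..} else {})"
    proof (rule emeasure_eq_AE)
      show "AE b in \<mu>. b \<in> A \<inter> {0..} \<longleftrightarrow> b \<in> (if r\<^sub>2 \<in> A then {0..} else {})"
        using AE by eventually_elim (use r in auto)
    qed auto
    also have "\<dots> = ennreal p * indicator A r\<^sub>2"
      by (simp add: emeasure_eq_measure p_def)
    finally show ?thesis .
  qed
  show "two_point_distribution \<mu>"
    unfolding two_point_distribution_def
    using r em measure_nonneg_pos measure_nonneg_less_1
    by (intro conjI exI[of _ r\<^sub>1] exI[of _ r\<^sub>2] exI[of _ p]) (auto simp: p_def)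
qed

end

section \<open>Monotonicity of the volatility in time, with the equality case\<close>

theorem corollary3p8:
  fixes \<mu> :: "real measure"
  assumes "prob_space \<mu>"
    and "sets \<mu> = sets borel"
    and "0 < measure \<mu> {0..}" and "measure \<mu> {0..} < 1"
    and "\<exists>\<epsilon>>0. integrable \<mu> (\<lambda>b. exp (\<epsilon> * b\<^sup>2))"
  shows "(\<forall>p\<in>{0<..<1}. antimono_on {0..} (\<lambda>t. volatility \<mu> t p)) \<and>
         (\<not> two_point_distribution \<mu> \<longrightarrow>
            (\<forall>p\<in>{0<..<1}. strict_antimono_on {0..} (\<lambda>t. volatility \<mu> t p))) \<and>
         (two_point_distribution \<mu> \<longrightarrow>
            (\<forall>p\<in>{0<..<1}. (\<lambda>t. volatility \<mu> t p) constant_on {0..}))"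
proof -
  obtain \<epsilon> where "0 < \<epsilon>" "integrable \<mu> (\<lambda>b. exp (\<epsilon> * b\<^sup>2))" using assms(5) by blast
  then interpret gaussian_moment \<mu> \<epsilon>
    using assms by (simp add: gaussian_moment_def gaussian_moment_axioms_def)
  show ?thesis
  proof (intro conjI impI ballI)
    fix p :: real assume p: "p \<in> {0<..<1}"
    show "antimono_on {0..} (\<lambda>t. volatility \<mu> t p)"
    proof (rule monotone_onI)
      fix s t :: real assume "s \<in> {0..}" "s \<le> t"
      then show "volatility \<mu> t p \<le> volatility \<mu> s p"
        using volatility_antimono(1)[of s t p] p by (cases "s = t") auto
    qed
  next
    fix p :: real assume n: "\<not> two_point_distribution \<mu>" and p: "p \<in> {0<..<1}"
    show "strict_antimono_on {0..} (\<lambda>t. volatility \<mu> t p)"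
    proof (rule monotone_onI)
      fix s t :: real assume "s \<in> {0..}" "s < t"
      \<comment> \<open>Equality at even one pair \<open>s < t\<close> would already make
        \<open>\<mu>\<close> a two-point distribution.\<close>
      then show "volatility \<mu> t p < volatility \<mu> s p"
        using volatility_antimono[of s t p] n p unfolding two_point_distribution_iff
        by (auto simp: order_less_le)
    qed
  next
    fix p :: real assume tp: "two_point_distribution \<mu>" and p: "p \<in> {0<..<1}"
    from tp obtain r\<^sub>1 r\<^sub>2 where "r\<^sub>1 < 0" "0 \<le> r\<^sub>2" "AE b in \<mu>. b = r\<^sub>1 \<or> b = r\<^sub>2"
      unfolding two_point_distribution_iff by blast
    then show "(\<lambda>t. volatility \<mu> t p) constant_on {0..}"
      using two_point_volatility[of r\<^sub>1 r\<^sub>2 _ p] p unfolding constant_on_def by auto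
  qed
qed

end
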